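(* There exists $K>0$ such that for every $\kappa\in\mathbb{R}$: if $z(t)$ is a bounded orbit of $$z'=\overline{z}\,\bigl(1+|z|^2\exp(i\kappa t)\bigr),\qquad z(t)\in\mathbb{C},$$ then either $z(t)\equiv 0$ or there exists $t_1\in\mathbb{R}$ such that $|z(t_1)|\ge K|\kappa|^{1/4}$.
   Context: A bounded orbit is a solution $z:\mathbb{R}\to\mathbb{C}$ defined for all times with $\sup_{t\in\mathbb{R}}|z(t)|<\infty$. $\overline{z}$ denotes complex conjugation. *)

theory Defs
  imports "HOL-Analysis.Analysis"
begin

definition bounded_orbit :: "(real \<Rightarrow> complex \<Rightarrow> complex) \<Rightarrow> (real \<Rightarrow> complex) \<Rightarrow> bool" where
  "bounded_orbit f z \<longleftrightarrow>
     (\<forall>t. (z has_vector_derivative f t (z t)) (at t)) \<and> bounded (range z)"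

definition planar_field :: "real \<Rightarrow> real \<Rightarrow> complex \<Rightarrow> complex" where
  "planar_field \<kappa> t z =
     cnj z * (1 + complex_of_real ((cmod z)\<^sup>2) * exp (\<i> * complex_of_real (\<kappa> * t)))"

end

theory Submission
  imports Defs
begin

text \<open>
  The proof exhibits a Lyapunov function \<open>L\<close> of indefinite sign. Along solutions,
  \<open>(Re (z\<^sup>2))' = 2 |z|\<^sup>2 (1 + |z|\<^sup>2 cos (\<kappa> t))\<close>. For \<open>|z| < 1/4\<close> the right-hand side is at least \<open>|z|\<^sup>2\<close>;
  this settles \<open>|\<kappa>| < 1\<close> with \<open>L = Re (z\<^sup>2)\<close>. For \<open>|\<kappa>| \<ge> 1\<close> the oscillating term is averaged out, that is,
  integrated by parts: the function \<open>L = Re (z\<^sup>2) - 2 |z|\<^sup>4 sin (\<kappa> t) / \<kappa>\<close> satisfies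
  \<open>L' = 2 |z|\<^sup>2 + O(|z|\<^sup>4 (1 + |z|\<^sup>2) / |\<kappa>|)\<close>, and the error is at most \<open>|z|\<^sup>2\<close> for
  \<open>|z| < K |\<kappa>|\<^bsup>1/4\<^esup>\<close> with \<open>K\<close> small. In both cases \<open>|L| \<le> 2 |z|\<^sup>2 \<le> 2 L'\<close>, and a bounded
  function on the whole line with \<open>|L| \<le> C L'\<close> vanishes (\<open>bounded_dominated_by_deriv_eq_0\<close>), hence so does \<open>z\<close>.
  The value \<open>K = 1/4\<close> works.
\<close>

lemma bounded_deriv_ge_imp_le:
  fixes L D :: "real \<Rightarrow> real"
  assumes der: "\<And>t. (L has_real_derivative D t) (at t)"
    and bnd: "\<And>t. L t \<le> B"
    and C: "C > 0"
    and dom: "\<And>t. \<bar>L t\<bar> \<le> C * D t"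
  shows "L t \<le> 0"
proof (rule ccontr)
  assume "\<not> L t \<le> 0"
  then have pos: "L t > 0" by simp
  have D0: "D s \<ge> 0" for s
    using dom[of s] C by (smt (verit) zero_le_mult_iff)
  have mono: "L a \<le> L b" if "a \<le> b" for a b
    using DERIV_nonneg_imp_nondecreasing[OF that] der D0 by blast
  define m where "m = L t / C"
  have m: "m > 0" using pos C by (simp add: m_def)
  have Dm: "D s \<ge> m" if "s \<ge> t" for s
  proof -
    have "L t \<le> C * D s" using mono[OF that] dom[of s] by linarith
    then show ?thesis using C by (simp add: m_def field_simps)
  qed
  define h where "h = (B - L t) / m + 1"
  have h: "h > 0" using m bnd[of t] by (simp add: h_def add_nonneg_pos)
  have "\<exists>z>t. z < t + h \<and> L (t + h) - L t = (t + h - t) * D z"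
    using MVT2[of t "t + h" L D] h der by simp
  then obtain s where s: "s > t" "L (t + h) - L t = h * D s" by auto
  have "h * m \<le> h * D s" using Dm[of s] s h by simp
  moreover have "h * m = B - L t + m" using m by (simp add: h_def field_simps)
  ultimately show False using s bnd[of "t + h"] m by linarith
qed

text \<open>
  If \<open>L t > 0\<close>, then \<open>L\<close> grows at least linearly to the right of \<open>t\<close>; if \<open>L t < 0\<close>, it decreases at
  least linearly to the left, which is the same statement for \<open>\<lambda>s. - L (- s)\<close>.
\<close>
lemma bounded_dominated_by_deriv_eq_0:
  fixes L D :: "real \<Rightarrow> real"
  assumes der: "\<And>t. (L has_real_derivative D t) (at t)"
    and bnd: "\<And>t. \<bar>L t\<bar> \<le> B"
    and C: "C > 0"
    and dom: "\<And>t. \<bar>L t\<bar> \<le> C * D t"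
  shows "L t = 0"
proof -
  have "L t \<le> 0"
    by (rule bounded_deriv_ge_imp_le[OF der _ C dom, where B = B]) (rule abs_le_D1[OF bnd])
  moreover have "- L (- (- t)) \<le> 0"
  proof (rule bounded_deriv_ge_imp_le[where L = "\<lambda>s. - L (- s)" and D = "\<lambda>s. D (- s)" and B = B])
    show "((\<lambda>s. - L (- s)) has_real_derivative D (- s)) (at s)" for s
      by (rule derivative_eq_intros DERIV_chain2[OF der] refl | simp)+
    show "- L (- s) \<le> B" for s using bnd[of "- s"] by linarith
    show "\<bar>- L (- s)\<bar> \<le> C * D (- s)" for s using dom[of "- s"] by simp
  qed (rule C)
  ultimately show ?thesis by simp
qed

text \<open>The real form of the equation, with \<open>r = |z|\<^sup>2\<close>.\<close>
lemma bounded_orbit_planar_field_components: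
  assumes "bounded_orbit (planar_field \<kappa>) z"
  defines "r \<equiv> \<lambda>t. (Re (z t))\<^sup>2 + (Im (z t))\<^sup>2"
  shows "((\<lambda>t. Re (z t)) has_real_derivative
            Re (z t) * (1 + r t * cos (\<kappa> * t)) + Im (z t) * (r t * sin (\<kappa> * t))) (at t)"
    and "((\<lambda>t. Im (z t)) has_real_derivative
            Re (z t) * (r t * sin (\<kappa> * t)) - Im (z t) * (1 + r t * cos (\<kappa> * t))) (at t)"
proof -
  have der: "(z has_vector_derivative planar_field \<kappa> t (z t)) (at t)"
    using assms(1) by (simp add: bounded_orbit_def)
  have e: "exp (\<i> * complex_of_real (\<kappa> * t)) = Complex (cos (\<kappa> * t)) (sin (\<kappa> * t))"
    by (metis cis.code cis_conv_exp)
  have p: "planar_field \<kappa> t (z t) =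
      Complex (Re (z t) * (1 + r t * cos (\<kappa> * t)) + Im (z t) * (r t * sin (\<kappa> * t)))
              (Re (z t) * (r t * sin (\<kappa> * t)) - Im (z t) * (1 + r t * cos (\<kappa> * t)))"
    unfolding planar_field_def e cmod_power2 r_def by (simp add: complex_eq_iff)
  show "((\<lambda>t. Re (z t)) has_real_derivative
            Re (z t) * (1 + r t * cos (\<kappa> * t)) + Im (z t) * (r t * sin (\<kappa> * t))) (at t)"
    using bounded_linear.has_vector_derivative[OF bounded_linear_Re der]
    by (simp add: p has_real_derivative_iff_has_vector_derivative)
  show "((\<lambda>t. Im (z t)) has_real_derivative
            Re (z t) * (r t * sin (\<kappa> * t)) - Im (z t) * (1 + r t * cos (\<kappa> * t))) (at t)"
    using bounded_linear.has_vector_derivative[OF bounded_linear_Im der]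
    by (simp add: p has_real_derivative_iff_has_vector_derivative)
qed

lemma abs_square_diff_le: "\<bar>x\<^sup>2 - y\<^sup>2\<bar> \<le> x\<^sup>2 + y\<^sup>2" for x y :: real
  by (simp add: abs_le_iff)

lemma abs_two_mult_le: "\<bar>2 * x * y\<bar> \<le> x\<^sup>2 + y\<^sup>2" for x y :: real
  using sum_squares_bound[of x y] sum_squares_bound[of x "- y"] by (simp add: abs_le_iff)

lemma bounded_orbit_eq_0_if_Lyapunov:
  assumes "bounded (range z)"
    and der: "\<And>t. (L has_real_derivative D t) (at t)"
    and L: "\<And>t. \<bar>L t\<bar> \<le> 2 * (cmod (z t))\<^sup>2"
    and D: "\<And>t. (cmod (z t))\<^sup>2 \<le> D t"
  shows "z t = 0"
proof -
  obtain b where b: "\<And>t. cmod (z t) \<le> b" using assms(1) by (auto simp: bounded_iff)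
  have L0: "L s = 0" for s
  proof (rule bounded_dominated_by_deriv_eq_0[where B = "2 * b\<^sup>2" and C = 2, OF der])
    show "\<bar>L s\<bar> \<le> 2 * b\<^sup>2" for s
      using L[of s] power_mono[OF b[of s], of 2] by simp
    show "\<bar>L s\<bar> \<le> 2 * D s" for s using L[of s] D[of s] by linarith
  qed simp
  then have "L = (\<lambda>_. 0)" by auto
  then have "D t = 0" using DERIV_unique[OF der[of t]] by simp
  then show ?thesis using D[of t] by simp
qed

lemma planar_orbit_small_eq_0:
  assumes orb: "bounded_orbit (planar_field \<kappa>) z"
    and small: "\<And>t. (cmod (z t))\<^sup>2 \<le> 1 / 2"
  shows "z t = 0"
proof -
  define r where "r = (\<lambda>t. (Re (z t))\<^sup>2 + (Im (z t))\<^sup>2)"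
  have r_cmod: "(cmod (z t))\<^sup>2 = r t" for t by (simp add: r_def cmod_power2)
  have r0: "r t \<ge> 0" for t by (simp add: r_def)
  note d = bounded_orbit_planar_field_components[OF orb, folded r_def]
  show ?thesis
  proof (rule bounded_orbit_eq_0_if_Lyapunov)
    show "bounded (range z)" using orb by (simp add: bounded_orbit_def)
    show "((\<lambda>t. (Re (z t))\<^sup>2 - (Im (z t))\<^sup>2) has_real_derivative
        2 * r t * (1 + r t * cos (\<kappa> * t))) (at t)" for t
      by (rule derivative_eq_intros d refl)+
        (simp add: r_def power2_eq_square algebra_simps)
    show "\<bar>(Re (z t))\<^sup>2 - (Im (z t))\<^sup>2\<bar> \<le> 2 * (cmod (z t))\<^sup>2" for t
      using abs_square_diff_le[of "Re (z t)" "Im (z t)"] r0[of t] by (simp add: r_cmod r_def)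
    show "(cmod (z t))\<^sup>2 \<le> 2 * r t * (1 + r t * cos (\<kappa> * t))" for t
    proof -
      have "r t * - 1 \<le> r t * cos (\<kappa> * t)" by (rule mult_left_mono) (use r0 in auto)
      then have "1 / 2 \<le> 1 + r t * cos (\<kappa> * t)" using small[of t] by (simp add: r_cmod)
      then have "2 * r t * (1 / 2) \<le> 2 * r t * (1 + r t * cos (\<kappa> * t))"
        by (rule mult_left_mono) (use r0 in auto)
      then show ?thesis by (simp add: r_cmod)
    qed
  qed
qed

text \<open>
  The averaged case. The two hypotheses on \<open>|z|\<close> are what \<open>|z| < K |\<kappa>|\<^bsup>1/4\<^esup>\<close> gives for \<open>K = 1/4\<close> and
  \<open>|\<kappa>| \<ge> 1\<close>; the second of them forces the exponent \<open>1/4\<close>.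
\<close>
lemma planar_orbit_averaged_eq_0:
  assumes orb: "bounded_orbit (planar_field \<kappa>) z"
    and \<kappa>: "\<kappa> \<noteq> 0"
    and small: "\<And>t. (cmod (z t))\<^sup>2 \<le> \<bar>\<kappa>\<bar> / 16"
    and small2: "\<And>t. ((cmod (z t))\<^sup>2)\<^sup>2 \<le> \<bar>\<kappa>\<bar> / 256"
  shows "z t = 0"
proof -
  define r where "r = (\<lambda>t. (Re (z t))\<^sup>2 + (Im (z t))\<^sup>2)"
  have r_cmod: "(cmod (z t))\<^sup>2 = r t" for t by (simp add: r_def cmod_power2)
  have r0: "r t \<ge> 0" for t by (simp add: r_def)
  note d = bounded_orbit_planar_field_components[OF orb, folded r_def]
  \<comment> \<open>Half the derivative of \<open>r\<close>.\<close>
  define q where "q = (\<lambda>t. ((Re (z t))\<^sup>2 - (Im (z t))\<^sup>2) * (1 + r t * cos (\<kappa> * t))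
      + 2 * Re (z t) * Im (z t) * (r t * sin (\<kappa> * t)))"
  have dr: "(r has_real_derivative 2 * q t) (at t)" for t
    unfolding r_def
    by (rule derivative_eq_intros d refl)+ (simp add: q_def r_def power2_eq_square algebra_simps)
  have q: "\<bar>q t\<bar> \<le> r t + 2 * (r t)\<^sup>2" for t
  proof -
    have rc: "\<bar>r t * cos (\<kappa> * t)\<bar> \<le> r t" and rs: "\<bar>r t * sin (\<kappa> * t)\<bar> \<le> r t"
      using r0[of t] mult_left_mono[OF abs_cos_le_one, of "r t" "\<kappa> * t"]
        mult_left_mono[OF abs_sin_le_one, of "r t" "\<kappa> * t"] by (simp_all add: abs_mult)
    have "\<bar>(Re (z t))\<^sup>2 - (Im (z t))\<^sup>2\<bar> * \<bar>1 + r t * cos (\<kappa> * t)\<bar> \<le> r t * (1 + r t)"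
      using abs_square_diff_le[of "Re (z t)" "Im (z t)"] rc r0[of t]
      by (intro mult_mono) (auto simp: r_def)
    moreover have "\<bar>2 * Re (z t) * Im (z t)\<bar> * \<bar>r t * sin (\<kappa> * t)\<bar> \<le> r t * r t"
      using abs_two_mult_le[of "Re (z t)" "Im (z t)"] rs r0[of t]
      by (intro mult_mono) (auto simp: r_def)
    moreover have "\<bar>q t\<bar> \<le> \<bar>(Re (z t))\<^sup>2 - (Im (z t))\<^sup>2\<bar> * \<bar>1 + r t * cos (\<kappa> * t)\<bar>
        + \<bar>2 * Re (z t) * Im (z t)\<bar> * \<bar>r t * sin (\<kappa> * t)\<bar>"
      unfolding q_def abs_mult[symmetric] by (rule abs_triangle_ineq)
    ultimately show ?thesis by (simp add: power2_eq_square algebra_simps)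
  qed
  show ?thesis
  proof (rule bounded_orbit_eq_0_if_Lyapunov)
    show "bounded (range z)" using orb by (simp add: bounded_orbit_def)
    show "((\<lambda>t. (Re (z t))\<^sup>2 - (Im (z t))\<^sup>2 - 2 * (r t)\<^sup>2 * (sin (\<kappa> * t) / \<kappa>)) has_real_derivative
        2 * r t - 8 * r t * q t * (sin (\<kappa> * t) / \<kappa>)) (at t)" for t
    proof -
      have 1: "((\<lambda>t. (Re (z t))\<^sup>2 - (Im (z t))\<^sup>2) has_real_derivative
          2 * r t * (1 + r t * cos (\<kappa> * t))) (at t)"
        by (rule derivative_eq_intros d refl)+
          (simp add: r_def power2_eq_square algebra_simps)
      have 2: "((\<lambda>t. sin (\<kappa> * t) / \<kappa>) has_real_derivative cos (\<kappa> * t)) (at t)"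
        by (rule derivative_eq_intros refl | simp add: \<kappa>)+
      show ?thesis
        by (rule derivative_eq_intros 1 2 dr refl)+ (simp add: power2_eq_square algebra_simps)
    qed
    have sk: "\<bar>sin (\<kappa> * t) / \<kappa>\<bar> \<le> 1 / \<bar>\<kappa>\<bar>" for t
      by (simp add: abs_divide divide_right_mono)
    show "\<bar>(Re (z t))\<^sup>2 - (Im (z t))\<^sup>2 - 2 * (r t)\<^sup>2 * (sin (\<kappa> * t) / \<kappa>)\<bar> \<le> 2 * (cmod (z t))\<^sup>2" for t
    proof -
      have "\<bar>2 * (r t)\<^sup>2 * (sin (\<kappa> * t) / \<kappa>)\<bar> \<le> 2 * (r t)\<^sup>2 * (1 / \<bar>\<kappa>\<bar>)"
        unfolding abs_mult[of "2 * (r t)\<^sup>2"] using sk[of t] by (intro mult_mono) auto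
      also have "\<dots> = 2 * r t * (r t / \<bar>\<kappa>\<bar>)" by (simp add: power2_eq_square)
      also have "\<dots> \<le> 2 * r t * (1 / 16)"
        using small[of t] r0[of t] \<kappa>
        by (intro mult_left_mono) (simp_all add: r_cmod divide_le_eq)
      finally show ?thesis
        using abs_square_diff_le[of "Re (z t)" "Im (z t)"] r0[of t]
          fun_cong[OF r_def, of t]
        unfolding r_cmod by linarith
    qed
    show "(cmod (z t))\<^sup>2 \<le> 2 * r t - 8 * r t * q t * (sin (\<kappa> * t) / \<kappa>)" for t
    proof -
      have "\<bar>q t * (sin (\<kappa> * t) / \<kappa>)\<bar> \<le> (r t + 2 * (r t)\<^sup>2) * (1 / \<bar>\<kappa>\<bar>)"
        unfolding abs_mult using sk[of t] q[of t] r0[of t] by (intro mult_mono) auto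
      also have "\<dots> = r t / \<bar>\<kappa>\<bar> + 2 * ((r t)\<^sup>2 / \<bar>\<kappa>\<bar>)" by (simp add: add_divide_distrib)
      also have "\<dots> \<le> 1 / 16 + 2 * (1 / 256)"
        using small[of t] small2[of t] \<kappa>
        by (intro add_mono mult_left_mono) (simp_all add: r_cmod divide_le_eq)
      finally have "q t * (sin (\<kappa> * t) / \<kappa>) \<le> 1 / 8" by linarith
      then have "8 * r t * (q t * (sin (\<kappa> * t) / \<kappa>)) \<le> 8 * r t * (1 / 8)"
        by (rule mult_left_mono) (use r0 in auto)
      then show ?thesis by (simp add: r_cmod algebra_simps)
    qed
  qed
qed

theorem mainTheorem3:
  shows "\<exists>K::real. K > 0 \<and>
    (\<forall>(\<kappa>::real) (z :: real \<Rightarrow> complex). bounded_orbit (planar_field \<kappa>) z \<longrightarrow>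
       (\<forall>t. z t = 0) \<or> (\<exists>t1. cmod (z t1) \<ge> K * \<bar>\<kappa>\<bar> powr (1/4)))"
proof -
  have "\<forall>t. z t = 0"
    if orb: "bounded_orbit (planar_field \<kappa>) z"
      and less: "\<And>t. cmod (z t) < 1 / 4 * \<bar>\<kappa>\<bar> powr (1/4)" for \<kappa> z
  proof -
    define u where "u = \<bar>\<kappa>\<bar> powr (1/4)"
    have u0: "u \<ge> 0" by (simp add: u_def)
    have u4: "u ^ 4 = \<bar>\<kappa>\<bar>"
      by (cases "\<kappa> = 0") (simp_all add: u_def powr_power)
    have sq: "(cmod (z t))\<^sup>2 \<le> u\<^sup>2 / 16" for t
      using power_mono[OF less_imp_le[OF less[of t]], of 2]
      by (simp add: u_def power_mult_distrib power_divide)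
    show ?thesis
    proof (cases "\<bar>\<kappa>\<bar> < 1")
      case True
      then have "u \<le> 1" unfolding u_def by (intro powr_le1) auto
      then have "u\<^sup>2 \<le> 1" using u0 by (simp add: power_le_one)
      then have "(cmod (z t))\<^sup>2 \<le> 1 / 2" for t using sq[of t] by linarith
      then show ?thesis using planar_orbit_small_eq_0[OF orb] by blast
    next
      case False
      then have "u \<ge> 1" unfolding u_def by (intro ge_one_powr_ge_zero) auto
      then have "u\<^sup>2 \<le> \<bar>\<kappa>\<bar>" unfolding u4[symmetric] by (intro power_increasing) auto
      then have 1: "(cmod (z t))\<^sup>2 \<le> \<bar>\<kappa>\<bar> / 16" for t using sq[of t] by linarith
      have 2: "((cmod (z t))\<^sup>2)\<^sup>2 \<le> \<bar>\<kappa>\<bar> / 256" for t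
        using power_mono[OF sq[of t], of 2] by (simp add: power_divide u4)
      have "\<kappa> \<noteq> 0" using False by auto
      then show ?thesis using planar_orbit_averaged_eq_0[OF orb _ 1 2] by blast
    qed
  qed
  then show ?thesis
    by (intro exI[of _ "1 / 4"]) (auto simp: not_le[symmetric])
qed

end
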